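(* Let $(X,\Phi)$ be a $\delta$-expansive NAIFS of continuous maps on a compact metric space $(X,d)$ for some $\delta>0$. Then, for every continuous potential $\psi:X\to\mathbb R$ and every $0<\epsilon<\delta$, $$P_{\mathrm{top}}(\Phi,\psi)=\limsup_{n\to\infty}\frac1n\log\Big(\frac1{\#(I^{1,n})}\sum_{w\in I^{1,n}}\sup_E\sum_{x\in E}e^{S_{w,n}\psi(x)}\Big),$$ where, for each $w\in I^{1,n}$, the supremum is taken over all $(w,n,\epsilon;\Phi)$-separated sets $E\subseteq X$.
   Context: NAIFS: A non-autonomous iterated function system (NAIFS) of continuous maps on a compact space $X$ is a pair $(X,\Phi)$ where $\Phi=\{\Phi^{(j)}\}_{j\ge 1}$, $\Phi^{(j)}=\{\varphi_i^{(j)}:X\to X\}_{i\in I^{(j)}}$ is a collection of continuous maps and $I^{(j)}$ is a non-empty finite index set. For $m,n\ge1$ put $I^{m,n}:=\prod_{j=0}^{n-1}I^{(m+j)}$ (words $w=w_m\cdots w_{m+n-1}$). For $w\in I^{m,n}$ and $1\le k\le n$ put $\varphi_w^{m,k}:=\varphi_{w_{m+k-1}}^{(m+k-1)}\circ\cdots\circ\varphi_{w_m}^{(m)}$, $\varphi_w^{m,0}:=\mathrm{id}_X$. Bowen metrics: for $w\in I^{m,n}$, $d_{w,n}(x,y):=\max_{0\le j\le n}d(\varphi_w^{m,j}(x),\varphi_w^{m,j}(y))$. For $w\in I^{1,n}$, a set $E\subseteq X$ is $(w,n,\epsilon;\Phi)$-separated if $d_{w,n}(x,y)>\epsilon$ for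 any distinct $x,y\in E$; a set $F\subseteq X$ is $(w,n,\epsilon;\Phi)$-spanning for $X$ if for each $x\in X$ there is $y\in F$ with $d_{w,n}(x,y)\le\epsilon$. Pressure: for continuous $\psi:X\to\mathbb R$ and $w\in I^{m,n}$, $S_{w,n}\psi(x):=\sum_{j=0}^n\psi(\varphi_w^{m,j}(x))$. The topological pressure is $$P_{\mathrm{top}}(\Phi,\psi):=\lim_{\epsilon\to0}\limsup_{n\to\infty}\frac1n\log\Big(\frac1{\#(I^{1,n})}\sum_{w\in I^{1,n}}\inf_F\sum_{x\in F}e^{S_{w,n}\psi(x)}\Big),$$ where the infimum is over all $(w,n,\epsilon;\Phi)$-spanning sets $F$ for $X$ (the limit exists in $(-\infty,\infty]$ by monotonicity in $\epsilon$). Expansivity: $(X,\Phi)$ is $\delta$-expansive if for any $\gamma>0$ there exists $k_0\ge1$ (depending on $\gamma$) such that for any $x,y\in X$ with $d(x,y)\ge\gamma$ one has $d_{w,n}(x,y)>\delta$ for each $w\in I^{m,n}$ with $m\ge1$ and $n\ge k_0$. *)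

theory Defs
  imports "HOL-Analysis.Analysis"
begin

text \<open>
  The space is a compact carrier set \<open>X\<close> in a metric space, the index sets \<open>I j\<close> are finite
  subsets of one type of indices, and \<open>\<phi> j i\<close> is the map with index \<open>i\<close> at time \<open>j\<close>.
  Time starts at \<open>1\<close>: \<open>I 0\<close> and \<open>\<phi> 0\<close> are never used.
\<close>

locale naifs =
  fixes X :: "'a :: metric_space set"
    and I :: "nat \<Rightarrow> 'i set"
    and \<phi> :: "nat \<Rightarrow> 'i \<Rightarrow> 'a \<Rightarrow> 'a"
  assumes compact_space: "compact X"
    and finite_index: "\<And>j. j \<ge> 1 \<Longrightarrow> finite (I j)"
    and nonempty_index: "\<And>j. j \<ge> 1 \<Longrightarrow> I j \<noteq> {}"
    and maps_into: "\<And>j i. j \<ge> 1 \<Longrightarrow> i \<in> I j \<Longrightarrow> \<phi> j i \<in> X \<rightarrow> X"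
    and maps_continuous: "\<And>j i. j \<ge> 1 \<Longrightarrow> i \<in> I j \<Longrightarrow> continuous_on X (\<phi> j i)"

text \<open>
  A word \<open>w\<^sub>m \<dots> w\<^bsub>m+n-1\<^esub>\<close> is a function on \<open>{m..<m + n}\<close>, so its letters keep their absolute time
  index. As the starting time cannot be read off from the function itself, the notions below
  take \<open>m\<close> as an argument.
\<close>

definition words :: "(nat \<Rightarrow> 'i set) \<Rightarrow> nat \<Rightarrow> nat \<Rightarrow> (nat \<Rightarrow> 'i) set" where
  "words I m n = (\<Pi>\<^sub>E j\<in>{m..<m + n}. I j)"

primrec word_map ::
  "(nat \<Rightarrow> 'i \<Rightarrow> 'a \<Rightarrow> 'a) \<Rightarrow> (nat \<Rightarrow> 'i) \<Rightarrow> nat \<Rightarrow> nat \<Rightarrow> 'a \<Rightarrow> 'a" where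
  "word_map \<phi> w m 0 = id"
| "word_map \<phi> w m (Suc k) = \<phi> (m + k) (w (m + k)) \<circ> word_map \<phi> w m k"

definition bowen_dist ::
  "(nat \<Rightarrow> 'i \<Rightarrow> 'a \<Rightarrow> 'a :: metric_space) \<Rightarrow> (nat \<Rightarrow> 'i) \<Rightarrow> nat \<Rightarrow> nat \<Rightarrow> 'a \<Rightarrow> 'a \<Rightarrow> real" where
  "bowen_dist \<phi> w m n x y = (MAX j\<in>{0..n}. dist (word_map \<phi> w m j x) (word_map \<phi> w m j y))"

definition birkhoff_sum ::
  "(nat \<Rightarrow> 'i \<Rightarrow> 'a \<Rightarrow> 'a) \<Rightarrow> (nat \<Rightarrow> 'i) \<Rightarrow> nat \<Rightarrow> nat \<Rightarrow> ('a \<Rightarrow> real) \<Rightarrow> 'a \<Rightarrow> real" where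
  "birkhoff_sum \<phi> w m n \<psi> x = (\<Sum>j=0..n. \<psi> (word_map \<phi> w m j x))"

definition separated_set ::
  "'a :: metric_space set \<Rightarrow> (nat \<Rightarrow> 'i \<Rightarrow> 'a \<Rightarrow> 'a) \<Rightarrow> (nat \<Rightarrow> 'i) \<Rightarrow> nat \<Rightarrow> real \<Rightarrow> 'a set \<Rightarrow> bool" where
  "separated_set X \<phi> w n \<epsilon> E \<longleftrightarrow>
     E \<subseteq> X \<and> (\<forall>x\<in>E. \<forall>y\<in>E. x \<noteq> y \<longrightarrow> bowen_dist \<phi> w 1 n x y > \<epsilon>)"

definition spanning_set ::
  "'a :: metric_space set \<Rightarrow> (nat \<Rightarrow> 'i \<Rightarrow> 'a \<Rightarrow> 'a) \<Rightarrow> (nat \<Rightarrow> 'i) \<Rightarrow> nat \<Rightarrow> real \<Rightarrow> 'a set \<Rightarrow> bool" where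
  "spanning_set X \<phi> w n \<epsilon> F \<longleftrightarrow>
     F \<subseteq> X \<and> (\<forall>x\<in>X. \<exists>y\<in>F. bowen_dist \<phi> w 1 n x y \<le> \<epsilon>)"

definition expansive ::
  "'a :: metric_space set \<Rightarrow> (nat \<Rightarrow> 'i set) \<Rightarrow> (nat \<Rightarrow> 'i \<Rightarrow> 'a \<Rightarrow> 'a) \<Rightarrow> real \<Rightarrow> bool" where
  "expansive X I \<phi> \<delta> \<longleftrightarrow>
     (\<forall>\<gamma>>0. \<exists>k\<^sub>0\<ge>1. \<forall>x\<in>X. \<forall>y\<in>X. dist x y \<ge> \<gamma> \<longrightarrow>
        (\<forall>m\<ge>1. \<forall>n\<ge>k\<^sub>0. \<forall>w\<in>words I m n. bowen_dist \<phi> w m n x y > \<delta>))"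

text \<open>The logarithm of an extended nonnegative real, with \<open>log 0 = -\<infinity>\<close> and \<open>log \<infinity> = \<infinity>\<close>.\<close>

definition ln_ennreal :: "ennreal \<Rightarrow> ereal" where
  "ln_ennreal x = (if x = 0 then -\<infinity> else if x = top then \<infinity> else ereal (ln (enn2real x)))"

text \<open>
  Sums over \<open>E\<close> and \<open>F\<close> are taken in \<^typ>\<open>ennreal\<close>, so that an infinite set contributes its true
  sum (which is \<open>\<infinity>\<close> for these bounded weights) and not the default value \<open>0\<close> of \<^const>\<open>sum\<close>.
\<close>

definition exp_sum ::
  "(nat \<Rightarrow> 'i \<Rightarrow> 'a \<Rightarrow> 'a) \<Rightarrow> (nat \<Rightarrow> 'i) \<Rightarrow> nat \<Rightarrow> ('a \<Rightarrow> real) \<Rightarrow> 'a set \<Rightarrow> ennreal" where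
  "exp_sum \<phi> w n \<psi> A = (\<Sum>\<^sub>\<infinity>x\<in>A. ennreal (exp (birkhoff_sum \<phi> w 1 n \<psi> x)))"

definition avg_growth :: "(nat \<Rightarrow> 'i set) \<Rightarrow> (nat \<Rightarrow> (nat \<Rightarrow> 'i) \<Rightarrow> ennreal) \<Rightarrow> ereal" where
  "avg_growth I a =
     limsup (\<lambda>n. ereal (1 / real n) *
       ln_ennreal ((\<Sum>w\<in>words I 1 n. a n w) / of_nat (card (words I 1 n))))"

definition pressure_spanning ::
  "'a :: metric_space set \<Rightarrow> (nat \<Rightarrow> 'i set) \<Rightarrow> (nat \<Rightarrow> 'i \<Rightarrow> 'a \<Rightarrow> 'a) \<Rightarrow> ('a \<Rightarrow> real) \<Rightarrow> real \<Rightarrow> ereal" where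
  "pressure_spanning X I \<phi> \<psi> \<epsilon> =
     avg_growth I (\<lambda>n w. INF F\<in>{F. spanning_set X \<phi> w n \<epsilon> F}. exp_sum \<phi> w n \<psi> F)"

definition topological_pressure ::
  "'a :: metric_space set \<Rightarrow> (nat \<Rightarrow> 'i set) \<Rightarrow> (nat \<Rightarrow> 'i \<Rightarrow> 'a \<Rightarrow> 'a) \<Rightarrow> ('a \<Rightarrow> real) \<Rightarrow> ereal" where
  "topological_pressure X I \<phi> \<psi> = Lim (at_right 0) (pressure_spanning X I \<phi> \<psi>)"

text \<open>The limit defining the pressure always exists, because its argument is antitone in \<open>\<epsilon>\<close>.\<close>

lemma ln_ennreal_mono:
  assumes "x \<le> y"
  shows "ln_ennreal x \<le> ln_ennreal y"
proof (cases "x = 0 \<or> y = top")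
  case True
  then show ?thesis
    using assms by (auto simp: ln_ennreal_def)
next
  case False
  then have "x \<noteq> 0" "y \<noteq> top" "y \<noteq> 0" "x \<noteq> top"
    using assms by (auto simp: top_unique)
  moreover from this have "0 < enn2real x" "enn2real x \<le> enn2real y"
    using assms by (auto simp: enn2real_positive_iff less_top intro!: enn2real_mono)
      (metis ennreal_zero_neq_top not_gr_zero)
  ultimately show ?thesis
    by (simp add: ln_ennreal_def)
qed

lemma avg_growth_mono:
  assumes "\<And>n w. a n w \<le> b n w"
  shows "avg_growth I a \<le> avg_growth I b"
  unfolding avg_growth_def
  by (intro Limsup_mono always_eventually allI ereal_mult_left_mono ln_ennreal_mono
      divide_right_mono_ennreal sum_mono assms) auto

lemma spanning_set_mono:
  "spanning_set X \<phi> w n \<epsilon> F \<Longrightarrow> \<epsilon> \<le> \<epsilon>' \<Longrightarrow> spanning_set X \<phi> w n \<epsilon>' F"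
  unfolding spanning_set_def by (meson order_trans)

lemma pressure_spanning_antimono:
  "\<epsilon> \<le> \<epsilon>' \<Longrightarrow> pressure_spanning X I \<phi> \<psi> \<epsilon>' \<le> pressure_spanning X I \<phi> \<psi> \<epsilon>"
  unfolding pressure_spanning_def
  by (intro avg_growth_mono INF_superset_mono) (auto intro: spanning_set_mono)

lemma pressure_spanning_tendsto:
  "((pressure_spanning X I \<phi> \<psi>) \<longlongrightarrow> topological_pressure X I \<phi> \<psi>) (at_right 0)"
proof -
  let ?f = "pressure_spanning X I \<phi> \<psi>"
  have "(?f \<longlongrightarrow> (SUP \<epsilon>\<in>{0<..}. ?f \<epsilon>)) (at_right 0)"
  proof (rule order_tendstoI)
    fix a assume "a < (SUP \<epsilon>\<in>{0<..}. ?f \<epsilon>)"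
    then obtain e where "e > 0" "a < ?f e"
      by (auto simp: less_SUP_iff)
    then show "\<forall>\<^sub>F \<epsilon> in at_right 0. a < ?f \<epsilon>"
      unfolding eventually_at_right_field
      by (intro exI[of _ e]) (auto elim!: less_le_trans intro!: pressure_spanning_antimono)
  next
    fix a assume a: "(SUP \<epsilon>\<in>{0<..}. ?f \<epsilon>) < a"
    show "\<forall>\<^sub>F \<epsilon> in at_right 0. ?f \<epsilon> < a"
      unfolding eventually_at_right_field
      by (intro exI[of _ 1]) (auto intro: le_less_trans[OF SUP_upper a])
  qed
  then show ?thesis
    unfolding topological_pressure_def by (metis tendsto_Lim trivial_limit_at_right_real)
qed

end

theory Submission
  imports Defs
begin

text \<open>
  Write \<open>S \<epsilon>\<close> and \<open>R \<epsilon>\<close> for the growth rates at scale \<open>\<epsilon>\<close> computed with separated and with spanning sets,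
  so that the pressure is the limit of \<open>R \<eta>\<close> as \<open>\<eta> \<rightarrow> 0\<close>. The theorem rests on three comparisons.

  \<^item> \<open>R \<eta> \<le> S \<eta>\<close>, because a maximal separated set is spanning (\<open>pressure_spanning_le_separated\<close>).
  \<^item> \<open>S \<epsilon> \<le> R \<eta> + s\<close> whenever \<open>2 \<eta> \<le> \<epsilon>\<close> and \<open>\<psi>\<close> varies by at most \<open>s\<close> at distance \<open>\<eta>\<close>: sending each
    point of a separated set to a point of a spanning set that follows its orbit is injective
    and costs at most \<open>s\<close> per step in the Birkhoff sum (\<open>pressure_separated_le_spanning\<close>).
  \<^item> \<open>S \<eta> \<le> S \<epsilon>\<close> for every \<open>\<eta> > 0\<close>, however small: by expansivity, two orbits that are \<open>\<eta>\<close> apart at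
    some time \<open>j \<le> n\<close> are more than \<open>\<delta>\<close> apart at some time between \<open>j\<close> and \<open>j + k\<close>, where \<open>k\<close> depends
    only on \<open>\<eta>\<close>. A set that is \<open>\<eta>\<close>-separated along a word is thus \<open>\<epsilon>\<close>-separated along each
    of its extensions by \<open>k\<close> letters (\<open>pressure_separated_le_of_expansive\<close>).

  The first and third comparison bound the pressure by \<open>S \<epsilon>\<close>. The second gives the reverse bound
  as \<open>\<eta> \<rightarrow> 0\<close>, since \<open>\<psi>\<close> is uniformly continuous and \<open>s\<close> may be taken arbitrarily small.

  The third comparison relates sums over words of different lengths. This is harmless because the
  growth rate is that of an average: every word of length \<open>n\<close> has the same number of extensions to
  length \<open>n + k\<close>, so averaging over the extensions leaves an average unchanged, and the fixed
  shift \<open>k\<close> and a bounded factor disappear in the limit (\<open>avg_growth_le_shift\<close>).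
\<close>

section \<open>Growth rates of averages over words\<close>

lemma ln_ennreal_exp_mult:
  "ln_ennreal (ennreal (exp c) * x) = ereal c + ln_ennreal x"
proof (cases "x = 0 \<or> x = top")
  case True
  then show ?thesis
    by (auto simp: ln_ennreal_def ennreal_mult_eq_top_iff ennreal_mult_top)
next
  case False
  then have "enn2real x > 0"
    by (auto simp: enn2real_positive_iff less_top zero_less_iff_neq_zero)
  then show ?thesis
    using False
    by (auto simp: ln_ennreal_def ennreal_mult_eq_top_iff enn2real_mult ln_mult)
qed

text \<open>
  The shift by \<open>k\<close> and the constant \<open>p\<close> are divided by \<open>n\<close> and vanish; only the slope \<open>s\<close> survives. Since
  either rate may be infinite, the limsups are never subtracted: each real \<open>c\<close> above the rate of
  \<open>v\<close> is turned into the real bound \<open>c + s\<close> for the rate of \<open>u\<close>.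
\<close>

lemma limsup_rate_shift:
  fixes u v :: "nat \<Rightarrow> ereal" and p s :: real
  assumes le: "\<And>n. u n \<le> ereal (p + s * real n) + v (n + k)"
  shows "limsup (\<lambda>n. ereal (1 / real n) * u n) \<le> limsup (\<lambda>n. ereal (1 / real n) * v n) + ereal s"
proof -
  let ?U = "limsup (\<lambda>n. ereal (1 / real n) * u n)"
  let ?V = "limsup (\<lambda>n. ereal (1 / real n) * v n)"
  have rate: "?U \<le> ereal (c + s)" if "?V < ereal c" for c :: real
  proof -
    have "\<forall>\<^sub>F n in sequentially. ereal (1 / real n) * v n < ereal c"
      using that by (rule Limsup_lessD)
    then obtain N where N: "\<And>n. n \<ge> N \<Longrightarrow> ereal (1 / real n) * v n < ereal c"
      by (auto simp: eventually_sequentially)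
    have v: "v n \<le> ereal (c * real n)" if "n \<ge> N" "n > 0" for n
      using N[OF that(1)] that(2) by (cases "v n") (auto simp: field_simps)
    have u: "ereal (1 / real n) * u n \<le> ereal (s + c + (p + c * real k) / real n)"
      if "n \<ge> N" "n > 0" for n
    proof -
      have "u n \<le> ereal (p + s * real n) + ereal (c * real (n + k))"
        using le[of n] v[of "n + k"] that by (meson add_left_mono order_trans trans_le_add1 trans_less_add1)
      then show ?thesis
        using that(2) by (cases "u n") (auto simp: field_simps)
    qed
    have "((\<lambda>n. ereal (s + c + (p + c * real k) / real n)) \<longlongrightarrow> ereal (s + c + 0)) sequentially"
      by (intro tendsto_intros lim_const_over_n)
    then have "limsup (\<lambda>n. ereal (s + c + (p + c * real k) / real n)) = ereal (s + c)"
      by (simp add: lim_imp_Limsup)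
    moreover have "?U \<le> limsup (\<lambda>n. ereal (s + c + (p + c * real k) / real n))"
      by (rule Limsup_mono, rule eventually_sequentiallyI[of "Suc N"], rule u) auto
    ultimately show ?thesis
      by (simp add: add.commute)
  qed
  show ?thesis
  proof (rule ereal_le_epsilon2)
    fix e :: real assume "0 < e"
    show "?U \<le> ?V + ereal s + ereal e"
    proof (cases ?V)
      case (real r)
      then show ?thesis
        using rate[of "r + e"] \<open>0 < e\<close> by (simp add: algebra_simps)
    next
      case MInf
      then have "?U \<le> ereal c" for c :: real
        using rate[of "c - s"] by simp
      then have "?U = - \<infinity>"
        using ereal_bot by blast
      then show ?thesis
        by simp
    qed simp
  qed
qed

context naifs
begin

text \<open>
  Each word of length \<open>n\<close> is the restriction of exactly \<open>card (I (m + n))\<close> words of length \<open>n + 1\<close>,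
  a number that does not depend on the word, so it cancels from the average.
\<close>

lemma average_over_one_step_extensions:
  fixes f :: "(nat \<Rightarrow> 'i) \<Rightarrow> ennreal"
  assumes "m \<ge> 1"
  shows "(\<Sum>w\<in>words I m (Suc n). f (restrict w {m..<m + n})) / of_nat (card (words I m (Suc n)))
       = (\<Sum>w\<in>words I m n. f w) / of_nat (card (words I m n))"
proof -
  let ?c = "\<lambda>(y, g). g(m + n := y)"
  have split: "words I m (Suc n) = ?c ` (I (m + n) \<times> words I m n)"
    unfolding words_def PiE_insert_eq[symmetric] by (simp add: atLeastLessThanSuc)
  have inj: "inj_on ?c (I (m + n) \<times> words I m n)"
    unfolding words_def by (rule inj_combinator) simp
  have ne: "card (I (m + n)) \<noteq> 0"
    using assms finite_index nonempty_index by auto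
  have restr: "restrict g {m..<m + n} = g" if "g \<in> words I m n" for g
    using that by (auto simp: words_def intro: PiE_restrict)
  have "(\<Sum>w\<in>words I m (Suc n). f (restrict w {m..<m + n}))
      = (\<Sum>(y, g)\<in>I (m + n) \<times> words I m n. f g)"
    unfolding split by (subst sum.reindex[OF inj]) (auto simp: restr intro!: sum.cong)
  also have "\<dots> = (\<Sum>w\<in>words I m n. f w) * of_nat (card (I (m + n)))"
    by (subst sum.cartesian_product[symmetric]) (simp add: mult.commute)
  finally have num: "(\<Sum>w\<in>words I m (Suc n). f (restrict w {m..<m + n}))
      = (\<Sum>w\<in>words I m n. f w) * of_nat (card (I (m + n)))" .
  have den: "card (words I m (Suc n)) = card (words I m n) * card (I (m + n))"
    unfolding split by (simp add: card_image[OF inj] card_cartesian_product)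
  show ?thesis
    unfolding num den of_nat_mult by (rule divide_mult_eq) (use ne in auto)
qed

lemma average_over_extensions:
  fixes f :: "(nat \<Rightarrow> 'i) \<Rightarrow> ennreal"
  assumes "m \<ge> 1"
  shows "(\<Sum>w\<in>words I m (n + k). f (restrict w {m..<m + n})) / of_nat (card (words I m (n + k)))
       = (\<Sum>w\<in>words I m n. f w) / of_nat (card (words I m n))"
proof (induction k)
  case 0
  have "restrict w {m..<m + n} = w" if "w \<in> words I m n" for w
    using that by (auto simp: words_def intro: PiE_restrict)
  then show ?case
    by simp
next
  case (Suc k)
  have "restrict (restrict w {m..<m + (n + k)}) {m..<m + n} = restrict w {m..<m + n}"
    for w :: "nat \<Rightarrow> 'i"
    by (auto simp: fun_eq_iff)
  then show ?case
    using Suc average_over_one_step_extensions[OF assms, of "\<lambda>w. f (restrict w {m..<m + n})" "n + k"]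
    by (simp del: restrict_apply restrict_restrict)
qed

text \<open>
  The common form of the comparisons of growth rates below: a bound for each word of length \<open>n\<close>
  against all of its extensions by \<open>k\<close> letters suffices, up to a factor whose exponential rate is \<open>s\<close>.
\<close>

lemma avg_growth_le_shift:
  assumes le: "\<And>n w. w \<in> words I 1 (n + k) \<Longrightarrow>
      a n (restrict w {1..<1 + n}) \<le> ennreal (exp (p + s * real n)) * b (n + k) w"
  shows "avg_growth I a \<le> avg_growth I b + ereal s"
  unfolding avg_growth_def
proof (rule limsup_rate_shift)
  fix n
  let ?avg = "\<lambda>c n. (\<Sum>w\<in>words I 1 n. c n w) / of_nat (card (words I 1 n)) :: ennreal"
  let ?W = "words I 1 (n + k)"
  have "?avg a n = (\<Sum>w\<in>?W. a n (restrict w {1..<1 + n})) / of_nat (card ?W)"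
    by (rule average_over_extensions[symmetric]) simp
  also have "\<dots> \<le> (\<Sum>w\<in>?W. ennreal (exp (p + s * real n)) * b (n + k) w) / of_nat (card ?W)"
    by (intro divide_right_mono_ennreal sum_mono le)
  also have "\<dots> = ennreal (exp (p + s * real n)) * ?avg b (n + k)"
    by (simp add: sum_distrib_left[symmetric] ennreal_times_divide)
  finally show "ln_ennreal (?avg a n) \<le> ereal (p + s * real n) + ln_ennreal (?avg b (n + k))"
    unfolding ln_ennreal_exp_mult[symmetric] by (rule ln_ennreal_mono)
qed

end

section \<open>Bowen metrics and exponential sums\<close>

lemma bowen_dist_le_iff:
  "bowen_dist \<phi> w m n x y \<le> r \<longleftrightarrow>
    (\<forall>j\<le>n. dist (word_map \<phi> w m j x) (word_map \<phi> w m j y) \<le> r)"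
  unfolding bowen_dist_def by (subst Max_le_iff) auto

lemma bowen_dist_less_iff:
  "r < bowen_dist \<phi> w m n x y \<longleftrightarrow>
    (\<exists>j\<le>n. r < dist (word_map \<phi> w m j x) (word_map \<phi> w m j y))"
  using bowen_dist_le_iff[of \<phi> w m n x y r] by (auto simp: not_le[symmetric])

lemma bowen_dist_commute: "bowen_dist \<phi> w m n x y = bowen_dist \<phi> w m n y x"
  by (simp add: bowen_dist_def dist_commute)

lemma word_map_cong:
  assumes "\<And>j. m \<le> j \<Longrightarrow> j < m + k \<Longrightarrow> w j = w' j"
  shows "word_map \<phi> w m k = word_map \<phi> w' m k"
  using assms by (induction k) auto

lemma word_map_add:
  "word_map \<phi> w m (j + i) = word_map \<phi> w (m + j) i \<circ> word_map \<phi> w m j"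
  by (induction i) (auto simp: fun_eq_iff add.assoc)

lemma (in naifs) word_map_into:
  assumes "w \<in> words I 1 n" "x \<in> X" "j \<le> n"
  shows "word_map \<phi> w 1 j x \<in> X"
  using assms(3)
proof (induction j)
  case (Suc j)
  then have "w (1 + j) \<in> I (1 + j)"
    using assms(1) by (auto simp: words_def)
  then show ?case
    using Suc maps_into[of "1 + j"] by auto
qed (use assms in simp)

lemma birkhoff_sum_restrict:
  "birkhoff_sum \<phi> (restrict w {m..<m + n}) m n \<psi> x = birkhoff_sum \<phi> w m n \<psi> x"
proof -
  have "word_map \<phi> (restrict w {m..<m + n}) m j = word_map \<phi> w m j" if "j \<le> n" for j
    using that by (intro word_map_cong) auto
  then show ?thesis
    by (simp add: birkhoff_sum_def)
qed

lemma bowen_dist_restrict: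
  "bowen_dist \<phi> (restrict w {m..<m + n}) m n x y = bowen_dist \<phi> w m n x y"
proof -
  have "word_map \<phi> (restrict w {m..<m + n}) m j = word_map \<phi> w m j" if "j \<le> n" for j
    using that by (intro word_map_cong) auto
  then show ?thesis
    unfolding bowen_dist_def by (intro arg_cong[where f = Max] image_cong) auto
qed

text \<open>
  Multiplication on \<^typ>\<open>ennreal\<close> is discontinuous at \<open>0 * \<infinity>\<close>, so the rule does not come from a general
  fact on topological semirings; it holds because the sum is a supremum of finite sums.
\<close>

lemma infsum_cmult_ennreal:
  fixes f :: "'b \<Rightarrow> ennreal"
  shows "(\<Sum>\<^sub>\<infinity>x\<in>A. c * f x) = c * (\<Sum>\<^sub>\<infinity>x\<in>A. f x)"
  by (simp add: nonneg_infsum_complete SUP_mult_left_ennreal sum_distrib_left)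

text \<open>
  Lets a positive finite factor be moved across an inequality, and so into an infimum.
\<close>

lemma le_exp_mult_ennreal_iff:
  "x \<le> ennreal (exp c) * y \<longleftrightarrow> ennreal (exp (- c)) * x \<le> y"
proof -
  have cancel: "ennreal (exp c) * (ennreal (exp (- c)) * z) = z"
    "ennreal (exp (- c)) * (ennreal (exp c) * z) = z" for z
    by (simp_all add: mult.assoc[symmetric] ennreal_mult[symmetric] exp_add[symmetric])
  show ?thesis
    by (metis cancel mult_left_mono zero_le)
qed

lemma exp_sum_le_inj:
  assumes "inj_on g E" "g ` E \<subseteq> F"
    and le: "\<And>x. x \<in> E \<Longrightarrow> birkhoff_sum \<phi> w 1 n \<psi> x \<le> c + birkhoff_sum \<phi> w' 1 n' \<psi> (g x)"
  shows "exp_sum \<phi> w n \<psi> E \<le> ennreal (exp c) * exp_sum \<phi> w' n' \<psi> F"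
proof -
  let ?h = "\<lambda>y. ennreal (exp (birkhoff_sum \<phi> w' 1 n' \<psi> y))"
  have "exp_sum \<phi> w n \<psi> E \<le> (\<Sum>\<^sub>\<infinity>x\<in>E. ennreal (exp c) * ?h (g x))"
    unfolding exp_sum_def
    by (rule infsum_mono[OF nonneg_summable_on_complete nonneg_summable_on_complete])
      (use le in \<open>auto simp: ennreal_mult[symmetric] exp_add[symmetric]\<close>)
  also have "\<dots> = ennreal (exp c) * (\<Sum>\<^sub>\<infinity>y\<in>g ` E. ?h y)"
    by (simp add: infsum_cmult_ennreal infsum_reindex[OF assms(1)] o_def)
  also have "\<dots> \<le> ennreal (exp c) * exp_sum \<phi> w' n' \<psi> F"
    unfolding exp_sum_def
    by (intro mult_left_mono infsum_mono_neutral nonneg_summable_on_complete) (use assms(2) in auto)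
  finally show ?thesis .
qed

section \<open>Separated and spanning sets\<close>

text \<open>
  If a point were at Bowen distance more than \<open>\<epsilon>\<close> from all points of a maximal separated set, it could
  be added to the set. Zorn's lemma gives maximality without a bound on the cardinality of
  separated sets.
\<close>

lemma separated_spanning_exists:
  assumes "\<epsilon> \<ge> 0"
  obtains E where "separated_set X \<phi> w n \<epsilon> E" "spanning_set X \<phi> w n \<epsilon> E"
proof -
  have "\<Union>C \<in> {E. separated_set X \<phi> w n \<epsilon> E}"
    if C: "subset.chain {E. separated_set X \<phi> w n \<epsilon> E} C" for C
  proof -
    have "\<exists>E\<in>C. x \<in> E \<and> y \<in> E" if xy: "x \<in> \<Union>C" "y \<in> \<Union>C" for x y
    proof -
      obtain A B where AB: "A \<in> C" "B \<in> C" "x \<in> A" "y \<in> B"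
        using xy by blast
      then have "A \<subseteq> B \<or> B \<subseteq> A"
        using C unfolding subset_chain_def by blast
      with AB show ?thesis
        by blast
    qed
    moreover have "separated_set X \<phi> w n \<epsilon> E" if "E \<in> C" for E
      using that C by (auto simp: subset_chain_def)
    ultimately show ?thesis
      unfolding separated_set_def mem_Collect_eq by (intro conjI ballI Sup_least) blast+
  qed
  from subset_Zorn'[OF this] obtain E
    where E: "separated_set X \<phi> w n \<epsilon> E"
      and max: "\<And>E'. separated_set X \<phi> w n \<epsilon> E' \<Longrightarrow> E \<subseteq> E' \<Longrightarrow> E' = E"
    by auto
  have "\<exists>y\<in>E. bowen_dist \<phi> w 1 n x y \<le> \<epsilon>" if x: "x \<in> X" for x
  proof (rule ccontr)
    assume "\<not> ?thesis"
    then have far: "\<And>y. y \<in> E \<Longrightarrow> \<epsilon> < bowen_dist \<phi> w 1 n x y"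
      by force
    moreover from this have "\<And>y. y \<in> E \<Longrightarrow> \<epsilon> < bowen_dist \<phi> w 1 n y x"
      by (subst bowen_dist_commute)
    ultimately have "separated_set X \<phi> w n \<epsilon> (insert x E)"
      using E x unfolding separated_set_def by blast
    then have "x \<in> E"
      using max by blast
    \<comment> \<open>A point is at Bowen distance 0 from itself, which is not above \<open>\<epsilon> \<ge> 0\<close>.\<close>
    from far[OF this] assms show False
      by (auto simp: bowen_dist_less_iff)
  qed
  then have "spanning_set X \<phi> w n \<epsilon> E"
    using E by (auto simp: spanning_set_def separated_set_def)
  with E show ?thesis
    by (rule that)
qed

section \<open>Comparison of the separated and spanning growth rates\<close>

definition pressure_separated ::
  "'a :: metric_space set \<Rightarrow> (nat \<Rightarrow> 'i set) \<Rightarrow> (nat \<Rightarrow> 'i \<Rightarrow> 'a \<Rightarrow> 'a) \<Rightarrow> ('a \<Rightarrow> real) \<Rightarrow> real \<Rightarrow> ereal" where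
  "pressure_separated X I \<phi> \<psi> \<epsilon> =
     avg_growth I (\<lambda>n w. SUP E\<in>{E. separated_set X \<phi> w n \<epsilon> E}. exp_sum \<phi> w n \<psi> E)"

lemma pressure_spanning_le_separated:
  assumes "\<epsilon> \<ge> 0"
  shows "pressure_spanning X I \<phi> \<psi> \<epsilon> \<le> pressure_separated X I \<phi> \<psi> \<epsilon>"
  unfolding pressure_spanning_def pressure_separated_def
proof (rule avg_growth_mono)
  fix n w
  obtain E where "separated_set X \<phi> w n \<epsilon> E" "spanning_set X \<phi> w n \<epsilon> E"
    using separated_spanning_exists[OF assms] .
  then show "(INF F\<in>{F. spanning_set X \<phi> w n \<epsilon> F}. exp_sum \<phi> w n \<psi> F)
      \<le> (SUP E\<in>{E. separated_set X \<phi> w n \<epsilon> E}. exp_sum \<phi> w n \<psi> E)"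
    by (intro order_trans[OF INF_lower[of E] SUP_upper[of E]]) auto
qed

context naifs
begin

text \<open>
  Two points of the separated set that follow the orbit of the same point within \<open>\<eta>\<close> follow each
  other within \<open>2 \<eta> \<le> \<epsilon>\<close>, hence coincide. The Birkhoff sum has \<open>n + 1\<close> terms, each changed by at most
  \<open>s\<close>; this is the factor \<open>exp (s + s n)\<close>.
\<close>

lemma pressure_separated_le_spanning:
  assumes "2 * \<eta> \<le> \<epsilon>"
    and osc: "\<And>x y. x \<in> X \<Longrightarrow> y \<in> X \<Longrightarrow> dist x y \<le> \<eta> \<Longrightarrow> \<psi> x \<le> \<psi> y + s"
  shows "pressure_separated X I \<phi> \<psi> \<epsilon> \<le> pressure_spanning X I \<phi> \<psi> \<eta> + ereal s"
  unfolding pressure_separated_def pressure_spanning_def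
proof (rule avg_growth_le_shift[where k = 0 and p = s])
  fix n w
  assume "w \<in> words I 1 (n + 0)"
  then have w: "w \<in> words I 1 n"
    by simp
  have "exp_sum \<phi> w n \<psi> E \<le> ennreal (exp (s + s * real n)) * exp_sum \<phi> w n \<psi> F"
    if E: "separated_set X \<phi> w n \<epsilon> E" and F: "spanning_set X \<phi> w n \<eta> F" for E F
  proof -
    have "\<forall>x\<in>E. \<exists>y\<in>F. bowen_dist \<phi> w 1 n x y \<le> \<eta>"
      using E F by (auto simp: separated_set_def spanning_set_def)
    then obtain g where g: "\<And>x. x \<in> E \<Longrightarrow> g x \<in> F" "\<And>x. x \<in> E \<Longrightarrow> bowen_dist \<phi> w 1 n x (g x) \<le> \<eta>"
      by metis
    show ?thesis
    proof (rule exp_sum_le_inj[of g])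
      show "inj_on g E"
      proof (rule inj_onI, rule ccontr)
        fix x y assume xy: "x \<in> E" "y \<in> E" "g x = g y" "x \<noteq> y"
        have "dist (word_map \<phi> w 1 j x) (word_map \<phi> w 1 j y) \<le> \<epsilon>" if "j \<le> n" for j
        proof -
          let ?z = "word_map \<phi> w 1 j (g x)"
          have "dist (word_map \<phi> w 1 j x) ?z \<le> \<eta>" "dist (word_map \<phi> w 1 j y) ?z \<le> \<eta>"
            using g(2)[of x] g(2)[of y] xy that by (auto simp: bowen_dist_le_iff)
          then show ?thesis
            using dist_triangle2[of "word_map \<phi> w 1 j x" "word_map \<phi> w 1 j y" ?z] assms(1) by linarith
        qed
        then have "bowen_dist \<phi> w 1 n x y \<le> \<epsilon>"
          by (simp add: bowen_dist_le_iff)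
        then show False
          using E xy by (force simp: separated_set_def)
      qed
      show "g ` E \<subseteq> F"
        using g by auto
      fix x assume x: "x \<in> E"
      then have X: "x \<in> X" "g x \<in> X"
        using E F g by (auto simp: separated_set_def spanning_set_def)
      have "birkhoff_sum \<phi> w 1 n \<psi> x \<le> (\<Sum>j=0..n. \<psi> (word_map \<phi> w 1 j (g x)) + s)"
        unfolding birkhoff_sum_def
        by (intro sum_mono osc word_map_into[OF w] X) (use g(2)[OF x] in \<open>auto simp: bowen_dist_le_iff\<close>)
      also have "\<dots> = s + s * real n + birkhoff_sum \<phi> w 1 n \<psi> (g x)"
        by (simp add: birkhoff_sum_def sum.distrib algebra_simps)
      finally show "birkhoff_sum \<phi> w 1 n \<psi> x \<le> s + s * real n + birkhoff_sum \<phi> w 1 n \<psi> (g x)" .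
    qed
  qed
  note le = this
  \<comment> \<open>The factor moves to the left-hand side, so that the infimum can be handled by its universal property.\<close>
  have "(SUP E\<in>{E. separated_set X \<phi> w n \<epsilon> E}. exp_sum \<phi> w n \<psi> E)
      \<le> ennreal (exp (s + s * real n)) * (INF F\<in>{F. spanning_set X \<phi> w n \<eta> F}. exp_sum \<phi> w n \<psi> F)"
    by (rule SUP_least, subst le_exp_mult_ennreal_iff, rule INF_greatest,
        subst le_exp_mult_ennreal_iff[symmetric]) (use le in auto)
  moreover have "restrict w {1..<1 + n} = w"
    using w by (auto simp: words_def intro: PiE_restrict)
  ultimately show "(SUP E\<in>{E. separated_set X \<phi> (restrict w {1..<1 + n}) n \<epsilon> E}.
        exp_sum \<phi> (restrict w {1..<1 + n}) n \<psi> E)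
      \<le> ennreal (exp (s + s * real n)) *
         (INF F\<in>{F. spanning_set X \<phi> w (n + 0) \<eta> F}. exp_sum \<phi> w (n + 0) \<psi> F)"
    by simp
qed

text \<open>
  A separation by \<open>\<eta>\<close> at time \<open>j \<le> n\<close> is amplified beyond \<open>\<delta>\<close> by the \<open>k\<close> letters that follow. When \<open>j\<close> is
  close to \<open>n\<close> these letters reach past the end of the original word; this is why the word has to
  be extended by \<open>k\<close> letters. Which letters are added does not matter, because expansivity is
  uniform over all words.
\<close>

lemma expansive_extension_separated:
  assumes exp: "\<And>x y m w. x \<in> X \<Longrightarrow> y \<in> X \<Longrightarrow> dist x y \<ge> \<eta> \<Longrightarrow> m \<ge> 1 \<Longrightarrow> w \<in> words I m k
      \<Longrightarrow> bowen_dist \<phi> w m k x y > \<delta>"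
    and w: "w \<in> words I 1 (n + k)"
    and E: "separated_set X \<phi> (restrict w {1..<1 + n}) n \<eta> E"
  shows "separated_set X \<phi> w (n + k) \<delta> E"
  unfolding separated_set_def
proof (intro conjI ballI impI)
  show "E \<subseteq> X"
    using E by (simp add: separated_set_def)
  fix x y assume xy: "x \<in> E" "y \<in> E" "x \<noteq> y"
  then have X: "x \<in> X" "y \<in> X"
    using E by (auto simp: separated_set_def)
  have "bowen_dist \<phi> w 1 n x y > \<eta>"
    using E xy unfolding separated_set_def bowen_dist_restrict by blast
  then obtain j where j: "j \<le> n" "\<eta> < dist (word_map \<phi> w 1 j x) (word_map \<phi> w 1 j y)"
    by (auto simp: bowen_dist_less_iff)
  let ?v = "restrict w {1 + j..<1 + j + k}"
  have "?v \<in> words I (1 + j) k"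
    using w j(1) by (auto simp: words_def PiE_iff)
  then have "bowen_dist \<phi> ?v (1 + j) k (word_map \<phi> w 1 j x) (word_map \<phi> w 1 j y) > \<delta>"
    using j w X by (intro exp word_map_into[of w "n + k"]) auto
  then obtain i where "i \<le> k" "\<delta> < dist (word_map \<phi> w 1 (j + i) x) (word_map \<phi> w 1 (j + i) y)"
    unfolding bowen_dist_restrict by (auto simp: bowen_dist_less_iff word_map_add)
  then show "bowen_dist \<phi> w 1 (n + k) x y > \<delta>"
    using j(1) unfolding bowen_dist_less_iff by (metis add_mono)
qed

text \<open>
  The extension by \<open>k\<close> letters adds \<open>k\<close> terms to each Birkhoff sum, each of them at least \<open>- M\<close>
  where \<open>M\<close> bounds \<open>\<bar>\<psi>\<bar>\<close> on \<open>X\<close>. The loss is a factor \<open>exp (k M)\<close>, which is independent of \<open>n\<close>.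
\<close>

lemma pressure_separated_le_of_expansive:
  assumes "expansive X I \<phi> \<delta>" "\<epsilon> \<le> \<delta>" "\<eta> > 0" "continuous_on X \<psi>"
  shows "pressure_separated X I \<phi> \<psi> \<eta> \<le> pressure_separated X I \<phi> \<psi> \<epsilon>"
proof -
  obtain k where k: "\<And>x y m w. x \<in> X \<Longrightarrow> y \<in> X \<Longrightarrow> dist x y \<ge> \<eta> \<Longrightarrow> m \<ge> 1 \<Longrightarrow> w \<in> words I m k
      \<Longrightarrow> bowen_dist \<phi> w m k x y > \<delta>"
    using assms(1,3) unfolding expansive_def by (meson order_refl)
  obtain M where M: "\<And>x. x \<in> X \<Longrightarrow> \<bar>\<psi> x\<bar> \<le> M"
    using compact_imp_bounded[OF compact_continuous_image[OF assms(4) compact_space]]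
    by (auto simp: bounded_iff)
  have "pressure_separated X I \<phi> \<psi> \<eta> \<le> pressure_separated X I \<phi> \<psi> \<epsilon> + ereal 0"
    unfolding pressure_separated_def
  proof (rule avg_growth_le_shift[where k = k and p = "real k * M"], rule SUP_least)
    fix n w E
    assume w: "w \<in> words I 1 (n + k)"
    let ?r = "restrict w {1..<1 + n}"
    assume "E \<in> {E. separated_set X \<phi> ?r n \<eta> E}"
    then have "separated_set X \<phi> w (n + k) \<delta> E" and EX: "E \<subseteq> X"
      using expansive_extension_separated[OF k w] by (auto simp: separated_set_def)
    then have sep: "separated_set X \<phi> w (n + k) \<epsilon> E"
      using assms(2) by (force simp: separated_set_def)
    have "exp_sum \<phi> ?r n \<psi> E \<le> ennreal (exp (real k * M + 0 * real n)) * exp_sum \<phi> w (n + k) \<psi> E"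
    proof (rule exp_sum_le_inj[of id])
      fix x assume "x \<in> E"
      then have "(\<Sum>j=n + 1..n + k. - M) \<le> (\<Sum>j=n + 1..n + k. \<psi> (word_map \<phi> w 1 j x))"
        by (intro sum_mono) (use EX M word_map_into[OF w] in \<open>force simp: abs_le_iff\<close>)
      moreover have "birkhoff_sum \<phi> w 1 (n + k) \<psi> x
          = birkhoff_sum \<phi> w 1 n \<psi> x + (\<Sum>j=n + 1..n + k. \<psi> (word_map \<phi> w 1 j x))"
        unfolding birkhoff_sum_def by (rule sum.ub_add_nat) simp
      ultimately show "birkhoff_sum \<phi> ?r 1 n \<psi> x
          \<le> real k * M + 0 * real n + birkhoff_sum \<phi> w 1 (n + k) \<psi> (id x)"
        unfolding birkhoff_sum_restrict by simp
    qed auto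
    also have "\<dots> \<le> ennreal (exp (real k * M + 0 * real n)) *
        (SUP E\<in>{E. separated_set X \<phi> w (n + k) \<epsilon> E}. exp_sum \<phi> w (n + k) \<psi> E)"
      by (intro mult_left_mono SUP_upper) (use sep in auto)
    finally show "exp_sum \<phi> ?r n \<psi> E \<le> \<dots>" .
  qed
  then show ?thesis
    by simp
qed

lemma pressure_separated_le_topological_pressure:
  assumes "continuous_on X \<psi>" "\<epsilon> > 0"
  shows "pressure_separated X I \<phi> \<psi> \<epsilon> \<le> topological_pressure X I \<phi> \<psi>"
proof (rule ereal_le_epsilon2)
  fix s :: real assume "0 < s"
  have "uniformly_continuous_on X \<psi>"
    using assms(1) compact_space by (rule compact_uniformly_continuous)
  then obtain d where d: "d > 0" "\<And>x y. x \<in> X \<Longrightarrow> y \<in> X \<Longrightarrow> dist y x < d \<Longrightarrow> dist (\<psi> y) (\<psi> x) < s"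
    using \<open>0 < s\<close> unfolding uniformly_continuous_on_def by metis
  have "\<forall>\<^sub>F \<eta> in at_right 0. pressure_separated X I \<phi> \<psi> \<epsilon> \<le> pressure_spanning X I \<phi> \<psi> \<eta> + ereal s"
    unfolding eventually_at_right_field
  proof (intro exI[of _ "min d (\<epsilon> / 2)"] conjI allI impI)
    show "0 < min d (\<epsilon> / 2)"
      using d assms by simp
    fix \<eta> assume "0 < \<eta>" "\<eta> < min d (\<epsilon> / 2)"
    then show "pressure_separated X I \<phi> \<psi> \<epsilon> \<le> pressure_spanning X I \<phi> \<psi> \<eta> + ereal s"
      using d(2) by (intro pressure_separated_le_spanning) (force simp: dist_real_def abs_less_iff)+
  qed
  moreover have "((\<lambda>\<eta>. pressure_spanning X I \<phi> \<psi> \<eta> + ereal s) \<longlongrightarrow> topological_pressure X I \<phi> \<psi> + ereal s)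
      (at_right 0)"
    by (intro tendsto_add_ereal_general1 pressure_spanning_tendsto tendsto_const) auto
  ultimately show "pressure_separated X I \<phi> \<psi> \<epsilon> \<le> topological_pressure X I \<phi> \<psi> + ereal s"
    by (intro tendsto_lowerbound) auto
qed

lemma topological_pressure_le_pressure_separated:
  assumes "expansive X I \<phi> \<delta>" "\<epsilon> \<le> \<delta>" "continuous_on X \<psi>"
  shows "topological_pressure X I \<phi> \<psi> \<le> pressure_separated X I \<phi> \<psi> \<epsilon>"
proof (rule tendsto_upperbound[OF pressure_spanning_tendsto])
  have "pressure_spanning X I \<phi> \<psi> \<eta> \<le> pressure_separated X I \<phi> \<psi> \<epsilon>" if "\<eta> > 0" for \<eta>
    using pressure_spanning_le_separated[of \<eta> X I \<phi> \<psi>]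
      pressure_separated_le_of_expansive[OF assms(1,2) that assms(3)] that by auto
  then show "\<forall>\<^sub>F \<eta> in at_right 0. pressure_spanning X I \<phi> \<psi> \<eta> \<le> pressure_separated X I \<phi> \<psi> \<epsilon>"
    by (simp add: eventually_at_right_less eventually_mono[OF eventually_at_right_less])
qed simp

end

section \<open>Pressure of expansive systems\<close>

theorem theorem5p10:
  fixes X :: "'a :: metric_space set"
    and I :: "nat \<Rightarrow> 'i set"
    and \<phi> :: "nat \<Rightarrow> 'i \<Rightarrow> 'a \<Rightarrow> 'a"
    and \<psi> :: "'a \<Rightarrow> real"
    and \<delta> \<epsilon> :: real
  assumes "naifs X I \<phi>"
    and "\<delta> > 0"
    and "expansive X I \<phi> \<delta>"
    and "continuous_on X \<psi>"
    and "0 < \<epsilon>" and "\<epsilon> < \<delta>"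
  shows "topological_pressure X I \<phi> \<psi> =
    limsup (\<lambda>n. ereal (1 / real n) *
      ln_ennreal ((\<Sum>w\<in>words I 1 n.
          SUP E\<in>{E. separated_set X \<phi> w n \<epsilon> E}. exp_sum \<phi> w n \<psi> E)
        / of_nat (card (words I 1 n))))"
proof -
  interpret naifs X I \<phi>
    by fact
  have "topological_pressure X I \<phi> \<psi> = pressure_separated X I \<phi> \<psi> \<epsilon>"
    using topological_pressure_le_pressure_separated[of \<delta> \<epsilon> \<psi>]
      pressure_separated_le_topological_pressure[of \<psi> \<epsilon>] assms by (simp add: antisym)
  then show ?thesis
    unfolding pressure_separated_def avg_growth_def .
qed

end
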